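(* Let $\alpha=[b_0;b_1,\ldots]$ and $\beta=[d_0;d_1,\ldots]$ be real irrational numbers and let $B_m$ and $D_n$ denote the denominators of their $m$th and $n$th convergents. Let $0\le\tau<1$ and let $H\ge1$ be an absolute constant. Suppose there exist a function $a:\mathbb{Z}_{\ge1}\to\mathbb{Z}_{\ge1}$, an increasing infinite sequence $(h_k)_{k\ge1}$ of positive integers and, for each $k\ge1$, an integer vector $(x_k,y_k,z_k,v_k)\in\mathbb{Z}^4$ such that $$D_{h_k}\le B_{a(h_k)+1}<D_{h_k+1},$$ $$q_k:=x_kB_{a(h_k)}+y_kB_{a(h_k)+1}=z_kD_{h_k}+v_kD_{h_k+1}\ge1,$$ $$\max\{|x_k|,|y_k|,|z_k|,|v_k|\}\le H\cdot D_{h_k+1}^{\tau}.$$ Then $$\|q_k\alpha\|\le\frac{(2H)^{2/(1+\tau)}(d_{h_k+1}+1)}{q_k^{(1-\tau)/(1+\tau)}},\qquad\|q_k\beta\|\le\frac{(2H)^{2/(1+\tau)}}{q_k^{(1-\tau)/(1+\tau)}}$$ hold for all $k\in\mathbb{Z}_{\ge1}$. Further, there are infinitely many distinct integers among the (effectively given) $q_k$ for which these bounds hold.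
   Context: For real $x$, $\|x\|:=\min_{k\in\mathbb{Z}}|x-k|$. For an irrational $\alpha=[b_0;b_1,b_2,\ldots]$ (simple continued fraction, $b_0\in\mathbb{Z}$, $b_n\in\mathbb{Z}_{\ge1}$ for $n\ge1$), the denominators of the convergents are given by $B_0=1$, $B_1=b_1$, $B_{n+2}=b_{n+2}B_{n+1}+B_n$; $D_n$ is defined likewise from the partial quotients $d_n$ of $\beta$. "Effectively given" only refers to the explicit formula defining $q_k$. *)

theory Defs
  imports Complex_Main
begin

(* dist_int_eq_round below shows that the infimum is a minimum. *)
definition dist_int :: "real \<Rightarrow> real" where
  "dist_int x = (INF k :: int. \<bar>x - of_int k\<bar>)"

lemma dist_int_eq_round: "dist_int x = \<bar>x - of_int (round x)\<bar>"
  unfolding dist_int_def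
proof (rule cInf_eq_minimum)
  show "\<bar>x - of_int (round x)\<bar> \<in> range (\<lambda>k::int. \<bar>x - of_int k\<bar>)"
    by blast
next
  fix r assume "r \<in> range (\<lambda>k::int. \<bar>x - of_int k\<bar>)"
  then show "\<bar>x - of_int (round x)\<bar> \<le> r"
    using round_diff_minimal by auto
qed

(* cfrac_fin b n is the value of the finite continued fraction [b 0; b 1, ..., b n]. *)
fun cfrac_fin :: "(nat \<Rightarrow> int) \<Rightarrow> nat \<Rightarrow> real" where
  "cfrac_fin b 0 = of_int (b 0)"
| "cfrac_fin b (Suc n) = of_int (b 0) + 1 / cfrac_fin (\<lambda>i. b (Suc i)) n"

(* x = [b 0; b 1, b 2, ...] as an infinite simple continued fraction. *)
definition is_cfrac :: "(nat \<Rightarrow> int) \<Rightarrow> real \<Rightarrow> bool" where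
  "is_cfrac b x \<longleftrightarrow> (\<forall>n\<ge>1. b n \<ge> 1) \<and> cfrac_fin b \<longlonglongrightarrow> x"

fun cfrac_denom :: "(nat \<Rightarrow> int) \<Rightarrow> nat \<Rightarrow> int" where
  "cfrac_denom b 0 = 1"
| "cfrac_denom b (Suc 0) = b 1"
| "cfrac_denom b (Suc (Suc n)) = b (Suc (Suc n)) * cfrac_denom b (Suc n) + cfrac_denom b n"

end

(* Convergents A_n/B_n of x satisfy |B_n x - A_n| <= 1/B_{n+1}, so an integer q = x_0 B_n + y_0 B_{n+1}
   with |x_0|, |y_0| <= M has ||q x|| <= 2M/B_{n+1}. With N = h_k and M = H D_{N+1}^tau this gives
   ||q beta|| <= 2H D_{N+1}^(tau-1), and the same bound for alpha up to the factor d_{N+1} + 1, because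
   B_{a(N)+1} >= D_N >= D_{N+1}/(d_{N+1} + 1). On the other hand q <= 2H D_{N+1}^(1+tau), and
   eliminating D_{N+1} yields the stated exponents. Since D_{N+1} tends to infinity, ||q_k beta|| tends
   to 0; as beta is irrational, no finite set of positive integers q can achieve this. *)
theory Submission
  imports Defs
begin

section \<open>Recurrences and growth of numerators and denominators\<close>

fun cfrac_num :: "(nat \<Rightarrow> int) \<Rightarrow> nat \<Rightarrow> int" where
  "cfrac_num b 0 = b 0"
| "cfrac_num b (Suc 0) = b 0 * b 1 + 1"
| "cfrac_num b (Suc (Suc n)) = b (Suc (Suc n)) * cfrac_num b (Suc n) + cfrac_num b n"

text \<open>\<open>cfrac_fin\<close> unfolds at the first partial quotient, whereas numerators and
  denominators recurse at the last one. This lemma and the next translate between the two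
  directions.\<close>

lemma cfrac_denom_Suc_shift: "cfrac_denom b (Suc n) = cfrac_num (\<lambda>i. b (Suc i)) n"
proof (induction n rule: induct_nat_012)
  case (ge2 n)
  then show ?case by (simp only: cfrac_denom.simps(3) cfrac_num.simps(3))
qed (simp_all add: algebra_simps)

lemma cfrac_num_Suc_shift:
  "cfrac_num b (Suc n) = b 0 * cfrac_num (\<lambda>i. b (Suc i)) n + cfrac_denom (\<lambda>i. b (Suc i)) n"
proof (induction n rule: induct_nat_012)
  case (ge2 n)
  have "cfrac_num b (Suc (Suc (Suc n)))
      = b (Suc (Suc (Suc n))) * cfrac_num b (Suc (Suc n)) + cfrac_num b (Suc n)"
    by simp
  then show ?case
    unfolding ge2 cfrac_num.simps(3)[of "\<lambda>i. b (Suc i)"] cfrac_denom.simps(3)[of "\<lambda>i. b (Suc i)"]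
    by (simp add: algebra_simps)
qed (simp_all add: algebra_simps)

lemma cfrac_denom_pos:
  assumes "\<forall>n\<ge>1. b n \<ge> 1"
  shows "cfrac_denom b n \<ge> 1"
proof (induction n rule: induct_nat_012)
  case (ge2 n)
  have "b (Suc (Suc n)) \<ge> 1"
    using assms by simp
  then have "b (Suc (Suc n)) * cfrac_denom b (Suc n) \<ge> 1 * 1"
    using ge2 by (intro mult_mono) auto
  then show ?case using ge2 by simp
qed (use assms in auto)

lemma cfrac_denom_Suc_Suc_ge:
  assumes "\<forall>n\<ge>1. b n \<ge> 1"
  shows "cfrac_denom b (Suc (Suc n)) \<ge> cfrac_denom b (Suc n) + cfrac_denom b n"
proof -
  have "b (Suc (Suc n)) * cfrac_denom b (Suc n) \<ge> 1 * cfrac_denom b (Suc n)"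
    using assms cfrac_denom_pos[OF assms, of "Suc n"] by (intro mult_right_mono) auto
  then show ?thesis by simp
qed

lemma cfrac_denom_le_Suc:
  assumes "\<forall>n\<ge>1. b n \<ge> 1"
  shows "cfrac_denom b n \<le> cfrac_denom b (Suc n)"
proof (cases n)
  case 0
  then show ?thesis using assms by simp
next
  case (Suc m)
  then show ?thesis
    using cfrac_denom_Suc_Suc_ge[OF assms, of m] cfrac_denom_pos[OF assms, of m] by simp
qed

text \<open>A linear lower bound is enough to make the denominators tend to infinity along any
  strictly increasing sequence of indices.\<close>

lemma cfrac_denom_ge:
  assumes "\<forall>n\<ge>1. b n \<ge> 1"
  shows "int n \<le> cfrac_denom b n"
proof (induction n rule: induct_nat_012)
  case (ge2 n)
  then show ?case
    using cfrac_denom_Suc_Suc_ge[OF assms, of n] cfrac_denom_pos[OF assms, of n]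
    by (simp del: cfrac_denom.simps)
qed (use assms in auto)

text \<open>The older denominator in the recurrence is at most the newer one. This is the source of
  the factor \<open>d (h k + 1) + 1\<close> in the bound for \<open>\<alpha>\<close>.\<close>

lemma cfrac_denom_Suc_le:
  assumes "\<forall>n\<ge>1. b n \<ge> 1"
  shows "cfrac_denom b (Suc n) \<le> (b (Suc n) + 1) * cfrac_denom b n"
proof (cases n)
  case 0
  then show ?thesis by simp
next
  case (Suc m)
  then show ?thesis
    using cfrac_denom_le_Suc[OF assms, of m] by (simp add: algebra_simps)
qed

section \<open>Approximation by convergents\<close>

lemma cfrac_fin_eq_num_div_denom:
  assumes "\<forall>n\<ge>1. b n \<ge> 1"
  shows "cfrac_fin b n = of_int (cfrac_num b n) / of_int (cfrac_denom b n)"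
  using assms
proof (induction n arbitrary: b)
  case 0
  then show ?case by simp
next
  case (Suc n)
  let ?b = "\<lambda>i. b (Suc i)"
  \<comment> \<open>The shifted fraction is inverted, so its numerator must be nonzero; it is a
    denominator of the original fraction, hence positive.\<close>
  have "cfrac_num ?b n \<ge> 1"
    using cfrac_denom_pos[OF Suc.prems, of "Suc n"] by (simp only: cfrac_denom_Suc_shift)
  moreover have "cfrac_fin ?b n = of_int (cfrac_num ?b n) / of_int (cfrac_denom ?b n)"
    using Suc by simp
  ultimately show ?case
    by (simp add: cfrac_num_Suc_shift cfrac_denom_Suc_shift field_simps)
qed

text \<open>The partial quotients cancel in the recurrence step, which leaves only a change of
  sign.\<close>

lemma cfrac_num_denom_det:
  "cfrac_num b (Suc n) * cfrac_denom b n - cfrac_num b n * cfrac_denom b (Suc n) = (-1) ^ n"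
proof (induction n)
  case (Suc n)
  then show ?case by (simp add: algebra_simps)
qed simp

(* As a function of m, the cross determinant solves the recurrence of the denominators, with initial
   values 0 and 1 at m = n, n + 1. *)
lemma cfrac_cross_det_bounds:
  fixes b :: "nat \<Rightarrow> int" and n m :: nat
  assumes "\<forall>n\<ge>1. b n \<ge> 1"
  defines "E \<equiv> \<lambda>m. (-1) ^ n * (cfrac_num b m * cfrac_denom b n - cfrac_num b n * cfrac_denom b m)"
  shows "0 \<le> E (n + m) \<and> E (n + m) * cfrac_denom b (Suc n) \<le> cfrac_denom b (n + m)"
proof (induction m rule: induct_nat_012)
  case 0
  then show ?case using cfrac_denom_pos[OF assms(1), of n] by (simp add: E_def)
next
  case 1
  have "E (Suc n) = 1"
    unfolding E_def cfrac_num_denom_det by (simp flip: power_add mult_2)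
  then show ?case by simp
next
  case (ge2 m)
  let ?c = "b (Suc (Suc (n + m)))"
  have E: "E (Suc (Suc (n + m))) = ?c * E (Suc (n + m)) + E (n + m)"
    by (simp add: E_def algebra_simps)
  have "?c \<ge> 1"
    using assms(1) by simp
  then have c: "?c \<ge> 0"
    by simp
  have "?c * (E (Suc (n + m)) * cfrac_denom b (Suc n)) \<le> ?c * cfrac_denom b (Suc (n + m))"
    using ge2 c by (intro mult_left_mono) auto
  then show ?case
    using ge2 c by (auto simp: E distrib_right mult.assoc)
qed

text \<open>The convergent of index \<open>n + m\<close> stands in for \<open>x\<close>: its
  deviation is a cross determinant divided by \<open>cfrac_denom b (n + m)\<close>, which is bounded
  uniformly in \<open>m\<close>. Letting \<open>m\<close> tend to infinity gives the claim.\<close>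

lemma convergent_error:
  assumes "is_cfrac b x"
  shows "\<bar>of_int (cfrac_denom b n) * x - of_int (cfrac_num b n)\<bar> \<le> 1 / of_int (cfrac_denom b (Suc n))"
proof -
  have b: "\<forall>n\<ge>1. b n \<ge> 1" and lim: "cfrac_fin b \<longlonglongrightarrow> x"
    using assms by (auto simp: is_cfrac_def)
  note pos = cfrac_denom_pos[OF b]
  have "\<bar>of_int (cfrac_denom b n) * cfrac_fin b (n + m) - of_int (cfrac_num b n)\<bar>
      \<le> 1 / of_int (cfrac_denom b (Suc n))" for m
  proof -
    define e where "e = cfrac_num b (n + m) * cfrac_denom b n - cfrac_num b n * cfrac_denom b (n + m)"
    have "0 \<le> (-1) ^ n * e" and le: "(-1) ^ n * e * cfrac_denom b (Suc n) \<le> cfrac_denom b (n + m)"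
      using cfrac_cross_det_bounds[OF b, of n m] by (auto simp: e_def)
    then have "\<bar>e\<bar> = (-1) ^ n * e"
      by (cases "even n") auto
    then have "real_of_int (\<bar>e\<bar> * cfrac_denom b (Suc n)) \<le> of_int (cfrac_denom b (n + m))"
      using le by (simp only: of_int_le_iff)
    then have "\<bar>of_int e\<bar> / of_int (cfrac_denom b (n + m)) \<le> 1 / real_of_int (cfrac_denom b (Suc n))"
      using pos[of "n + m"] pos[of "Suc n"] by (simp add: field_simps del: cfrac_denom.simps)
    moreover have "of_int (cfrac_denom b n) * cfrac_fin b (n + m) - of_int (cfrac_num b n)
        = of_int e / of_int (cfrac_denom b (n + m))"
      using pos[of "n + m"] by (simp add: cfrac_fin_eq_num_div_denom[OF b] e_def field_simps)
    ultimately show ?thesis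
      using pos[of "n + m"] by simp
  qed
  moreover have "(\<lambda>m. cfrac_fin b (n + m)) \<longlonglongrightarrow> x"
    using LIMSEQ_ignore_initial_segment[OF lim, of n] by (simp add: add.commute)
  then have "(\<lambda>m. \<bar>of_int (cfrac_denom b n) * cfrac_fin b (n + m) - of_int (cfrac_num b n)\<bar>)
      \<longlonglongrightarrow> \<bar>of_int (cfrac_denom b n) * x - of_int (cfrac_num b n)\<bar>"
    by (intro tendsto_intros)
  ultimately show ?thesis
    by (intro LIMSEQ_le_const2) auto
qed

section \<open>Distance to the nearest integer\<close>

lemma dist_int_le: "dist_int x \<le> \<bar>x - of_int k\<bar>"
  unfolding dist_int_eq_round by (rule round_diff_minimal)

lemma dist_int_pos:
  assumes "x \<notin> \<rat>"
  shows "dist_int x > 0"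
  using assms by (auto simp: dist_int_eq_round) (metis Rats_of_int)

text \<open>The same combination of the numerators is the integer to compare with. The error of the
  later convergent is weakened to that of the earlier one, so that both terms share a
  denominator.\<close>

lemma dist_int_combination_le:
  fixes M x :: real
  assumes "is_cfrac b x" and "\<bar>of_int r\<bar> \<le> M" and "\<bar>of_int s\<bar> \<le> M"
  shows "dist_int (of_int (r * cfrac_denom b n + s * cfrac_denom b (Suc n)) * x)
    \<le> 2 * M / of_int (cfrac_denom b (Suc n))"
proof -
  have b: "\<forall>n\<ge>1. b n \<ge> 1"
    using assms(1) by (auto simp: is_cfrac_def)
  define \<epsilon> where "\<epsilon> m = of_int (cfrac_denom b m) * x - of_int (cfrac_num b m)" for m
  let ?B = "real_of_int (cfrac_denom b (Suc n))"
  have B: "?B > 0" "?B \<le> of_int (cfrac_denom b (Suc (Suc n)))"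
    using cfrac_denom_pos[OF b, of "Suc n"] cfrac_denom_le_Suc[OF b, of "Suc n"]
    by (simp_all del: cfrac_denom.simps)
  have e0: "\<bar>\<epsilon> n\<bar> \<le> 1 / ?B"
    using convergent_error[OF assms(1)] by (simp add: \<epsilon>_def)
  have "\<bar>\<epsilon> (Suc n)\<bar> \<le> 1 / of_int (cfrac_denom b (Suc (Suc n)))"
    using convergent_error[OF assms(1)] unfolding \<epsilon>_def by blast
  also have "\<dots> \<le> 1 / ?B"
    using B by (intro divide_left_mono) auto
  finally have e1: "\<bar>\<epsilon> (Suc n)\<bar> \<le> 1 / ?B" .
  have "dist_int (of_int (r * cfrac_denom b n + s * cfrac_denom b (Suc n)) * x)
      \<le> \<bar>of_int (r * cfrac_denom b n + s * cfrac_denom b (Suc n)) * x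
          - of_int (r * cfrac_num b n + s * cfrac_num b (Suc n))\<bar>"
    by (rule dist_int_le)
  also have "\<dots> = \<bar>of_int r * \<epsilon> n + of_int s * \<epsilon> (Suc n)\<bar>"
    by (simp add: \<epsilon>_def algebra_simps)
  also have "\<dots> \<le> \<bar>of_int r\<bar> * \<bar>\<epsilon> n\<bar> + \<bar>of_int s\<bar> * \<bar>\<epsilon> (Suc n)\<bar>"
    by (metis abs_triangle_ineq abs_mult)
  also have "\<dots> \<le> M * (1 / ?B) + M * (1 / ?B)"
    using assms(2,3) e0 e1 by (intro add_mono mult_mono) auto
  finally show ?thesis by simp
qed

section \<open>Exponents and the simultaneous bounds\<close>

text \<open>Raising the bound on \<open>q\<close> to the power
  \<open>(1 - \<tau>) / (1 + \<tau>)\<close> turns \<open>u powr (1 + \<tau>)\<close> into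
  \<open>u powr (1 - \<tau>)\<close>, which cancels \<open>u powr (\<tau> - 1)\<close>. The powers
  of \<open>C\<close> then add up to \<open>2 / (1 + \<tau>)\<close>.\<close>

lemma powr_elimination_bound:
  fixes C \<tau> q u :: real
  assumes "C > 0" and "0 \<le> \<tau>" and "\<tau> < 1" and "q > 0" and "u > 0" and "q \<le> C * u powr (1 + \<tau>)"
  shows "C * u powr (\<tau> - 1) \<le> C powr (2 / (1 + \<tau>)) / q powr ((1 - \<tau>) / (1 + \<tau>))"
proof -
  let ?e = "(1 - \<tau>) / (1 + \<tau>)"
  have "q powr ?e \<le> (C * u powr (1 + \<tau>)) powr ?e"
    using assms by (intro powr_mono2) auto
  also have "\<dots> = C powr ?e * u powr (1 - \<tau>)"
    using assms by (simp add: powr_mult powr_powr)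
  finally have "C * u powr (\<tau> - 1) * q powr ?e
      \<le> C * u powr (\<tau> - 1) * (C powr ?e * u powr (1 - \<tau>))"
    using assms by (intro mult_left_mono) auto
  also have "\<dots> = (C powr 1 * C powr ?e) * (u powr (\<tau> - 1) * u powr (1 - \<tau>))"
    using assms by simp
  also have "\<dots> = C powr (1 + ?e)"
    using assms unfolding powr_add[symmetric] by simp
  also have "1 + ?e = 2 / (1 + \<tau>)"
    using assms by (simp add: field_simps)
  finally show ?thesis
    using assms by (simp add: field_simps)
qed

theorem theorem22:
  fixes \<alpha> \<beta> \<tau> H :: real
    and b d :: "nat \<Rightarrow> int"
    and B D :: "nat \<Rightarrow> int"
    and a h :: "nat \<Rightarrow> nat"
    and x y z v q :: "nat \<Rightarrow> int"
  assumes "\<alpha> \<notin> \<rat>" and "\<beta> \<notin> \<rat>"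
    and "is_cfrac b \<alpha>" and "is_cfrac d \<beta>"
    and "B = cfrac_denom b" and "D = cfrac_denom d"
    and "0 \<le> \<tau>" and "\<tau> < 1" and "H \<ge> 1"
    and "\<And>n. n \<ge> 1 \<Longrightarrow> a n \<ge> 1"
    and "strict_mono_on {1..} h" and "\<And>k. k \<ge> 1 \<Longrightarrow> h k \<ge> 1"
    and "\<And>k. k \<ge> 1 \<Longrightarrow> D (h k) \<le> B (a (h k) + 1) \<and> B (a (h k) + 1) < D (h k + 1)"
    and "\<And>k. k \<ge> 1 \<Longrightarrow> q k = x k * B (a (h k)) + y k * B (a (h k) + 1)"
    and "\<And>k. k \<ge> 1 \<Longrightarrow> q k = z k * D (h k) + v k * D (h k + 1)"
    and "\<And>k. k \<ge> 1 \<Longrightarrow> q k \<ge> 1"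
    and "\<And>k. k \<ge> 1 \<Longrightarrow>
           of_int (Max {\<bar>x k\<bar>, \<bar>y k\<bar>, \<bar>z k\<bar>, \<bar>v k\<bar>}) \<le> H * of_int (D (h k + 1)) powr \<tau>"
  shows "(\<forall>k\<ge>1.
            dist_int (of_int (q k) * \<alpha>)
              \<le> (2 * H) powr (2 / (1 + \<tau>)) * (of_int (d (h k + 1)) + 1)
                  / of_int (q k) powr ((1 - \<tau>) / (1 + \<tau>)) \<and>
            dist_int (of_int (q k) * \<beta>)
              \<le> (2 * H) powr (2 / (1 + \<tau>))
                  / of_int (q k) powr ((1 - \<tau>) / (1 + \<tau>))) \<and>
         infinite (q ` {1..})"
proof -
  have b: "\<forall>n\<ge>1. b n \<ge> 1" and d: "\<forall>n\<ge>1. d n \<ge> 1"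
    using assms(3,4) by (auto simp: is_cfrac_def)
  define u where "u k = real_of_int (D (h k + 1))" for k
  define M where "M k = H * u k powr \<tau>" for k
  have u: "u k \<ge> 1" for k
    using cfrac_denom_pos[OF d, of "h k + 1"] by (simp add: u_def assms(6))
  have coeffs: "\<bar>of_int (x k)\<bar> \<le> M k" "\<bar>of_int (y k)\<bar> \<le> M k"
    "\<bar>of_int (z k)\<bar> \<le> M k" "\<bar>of_int (v k)\<bar> \<le> M k" if "k \<ge> 1" for k
  proof -
    let ?S = "{\<bar>x k\<bar>, \<bar>y k\<bar>, \<bar>z k\<bar>, \<bar>v k\<bar>}"
    have "real_of_int t \<le> M k" if "t \<in> ?S" for t
    proof -
      have "t \<le> Max ?S"
        using that by (intro Max_ge) auto
      then have "real_of_int t \<le> of_int (Max ?S)"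
        by (simp only: of_int_le_iff)
      then show ?thesis
        using assms(17)[OF \<open>k \<ge> 1\<close>] unfolding M_def u_def by linarith
    qed
    from this[of "\<bar>x k\<bar>"] this[of "\<bar>y k\<bar>"] this[of "\<bar>z k\<bar>"] this[of "\<bar>v k\<bar>"]
    show "\<bar>of_int (x k)\<bar> \<le> M k" "\<bar>of_int (y k)\<bar> \<le> M k"
      "\<bar>of_int (z k)\<bar> \<le> M k" "\<bar>of_int (v k)\<bar> \<le> M k" by auto
  qed
  have M_div: "2 * M k / u k = 2 * H * u k powr (\<tau> - 1)" for k
    using u[of k] by (simp add: M_def powr_diff)
  have \<beta>_bound: "dist_int (of_int (q k) * \<beta>) \<le> 2 * H * u k powr (\<tau> - 1)" if "k \<ge> 1" for k
    using dist_int_combination_le[OF assms(4) coeffs(3,4)[OF that], of "h k"]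
    unfolding M_div[symmetric] by (simp add: assms(15)[OF that] assms(6) u_def)
  have \<alpha>_bound: "dist_int (of_int (q k) * \<alpha>) \<le> 2 * H * u k powr (\<tau> - 1) * (of_int (d (h k + 1)) + 1)"
    if "k \<ge> 1" for k
  proof -
    let ?B = "real_of_int (B (a (h k) + 1))" and ?d = "real_of_int (d (h k + 1)) + 1"
    have M: "M k \<ge> 0"
      using coeffs(1)[OF that] by linarith
    have d_pos: "d (h k + 1) \<ge> 1"
      using d by simp
    \<comment> \<open>Passing from \<open>B (a (h k) + 1)\<close> to \<open>u k\<close> costs the
      factor \<open>?d\<close>: the step from \<open>D (h k)\<close> to \<open>D (h k + 1)\<close>
      grows by at most this factor, and \<open>D (h k)\<close> is at most
      \<open>B (a (h k) + 1)\<close>.\<close>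
    have "D (h k + 1) \<le> (d (h k + 1) + 1) * D (h k)"
      using cfrac_denom_Suc_le[OF d, of "h k"] by (simp add: assms(6))
    also have "\<dots> \<le> (d (h k + 1) + 1) * B (a (h k) + 1)"
      using assms(13)[OF that] d_pos by (intro mult_left_mono) linarith+
    finally have "real_of_int (D (h k + 1)) \<le> of_int ((d (h k + 1) + 1) * B (a (h k) + 1))"
      by (simp only: of_int_le_iff)
    then have "u k \<le> ?d * ?B"
      by (simp add: u_def)
    moreover have B_pos: "?B > 0"
      using cfrac_denom_pos[OF b, of "a (h k) + 1"] by (simp add: assms(5))
    ultimately have "1 / ?B \<le> ?d / u k"
      using u[of k] by (simp add: field_simps)
    then have "2 * M k * (1 / ?B) \<le> 2 * M k * (?d / u k)"
      using M by (intro mult_left_mono) auto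
    moreover have "dist_int (of_int (q k) * \<alpha>) \<le> 2 * M k / ?B"
      using dist_int_combination_le[OF assms(3) coeffs(1,2)[OF that], of "a (h k)"] assms(14)[OF that]
      by (simp add: assms(5))
    ultimately have "dist_int (of_int (q k) * \<alpha>) \<le> 2 * M k / u k * ?d"
      by simp
    then show ?thesis
      by (simp only: M_div)
  qed
  have elim: "2 * H * u k powr (\<tau> - 1)
      \<le> (2 * H) powr (2 / (1 + \<tau>)) / of_int (q k) powr ((1 - \<tau>) / (1 + \<tau>))" if "k \<ge> 1" for k
  proof (rule powr_elimination_bound)
    have D: "0 \<le> real_of_int (D (h k))" "real_of_int (D (h k)) \<le> u k"
      using cfrac_denom_pos[OF d, of "h k"] cfrac_denom_le_Suc[OF d, of "h k"]
      by (simp_all add: assms(6) u_def)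
    \<comment> \<open>The representation of \<open>q k\<close> by the denominators of
      \<open>\<beta>\<close> is chosen because both of them are at most \<open>u k\<close>.\<close>
    have "real_of_int (q k) = of_int (z k) * of_int (D (h k)) + of_int (v k) * u k"
      using assms(15)[OF that] by (simp add: u_def)
    also have "\<dots> \<le> M k * u k + M k * u k"
      using coeffs(3,4)[OF that] D u[of k] by (intro add_mono mult_mono) auto
    also have "\<dots> = 2 * H * u k powr (1 + \<tau>)"
      using u[of k] by (simp add: M_def powr_add)
    finally show "real_of_int (q k) \<le> 2 * H * u k powr (1 + \<tau>)" .
  qed (use assms(7-9) assms(16)[OF that] u[of k] in auto)
  have "infinite (q ` {1..})"
  proof
    assume fin: "finite (q ` {1..})"
    \<comment> \<open>With finitely many values the smallest distance is attained, and it is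
      positive because a nonzero integer multiple of \<open>\<beta>\<close> is irrational.\<close>
    define \<delta> where "\<delta> = Min ((\<lambda>n. dist_int (of_int n * \<beta>)) ` q ` {1..})"
    have "dist_int (of_int (q k) * \<beta>) > 0" if "k \<ge> 1" for k
    proof (rule dist_int_pos)
      show "of_int (q k) * \<beta> \<notin> \<rat>"
      proof
        assume "of_int (q k) * \<beta> \<in> \<rat>"
        then have "of_int (q k) * \<beta> / of_int (q k) \<in> \<rat>"
          by (intro Rats_divide Rats_of_int)
        then show False
          using assms(2) assms(16)[OF that] by simp
      qed
    qed
    then have "\<delta> > 0"
      unfolding \<delta>_def using fin by (subst Min_gr_iff) auto
    \<comment> \<open>The sequence is indexed from 1, so the induction starts there, with
      \<open>h 1\<close> at least 1.\<close>
    have h: "k \<le> h k" if "k \<ge> 1" for k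
      using that
    proof (induction k rule: dec_induct)
      case base
      then show ?case using assms(12) by simp
    next
      case (step k)
      then have "h k < h (Suc k)"
        using assms(11) by (auto simp: strict_mono_on_def)
      then show ?case using step by simp
    qed
    have "real k \<le> u k" if "k \<ge> 1" for k
    proof -
      have "int k \<le> D (h k + 1)"
        using h[OF that] cfrac_denom_ge[OF d, of "h k + 1"] by (simp add: assms(6))
      then show ?thesis
        unfolding u_def by linarith
    qed
    then have "eventually (\<lambda>k. real k \<le> u k) sequentially"
      by (auto intro: eventually_sequentiallyI[of 1])
    then have "filterlim u at_top sequentially"
      by (rule filterlim_at_top_mono[OF filterlim_real_sequentially])
    \<comment> \<open>The exponent is negative because \<open>\<tau> < 1\<close>.\<close>
    then have "(\<lambda>k. u k powr (\<tau> - 1)) \<longlonglongrightarrow> 0"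
      using assms(8) by (intro tendsto_neg_powr) auto
    then have "(\<lambda>k. 2 * H * u k powr (\<tau> - 1)) \<longlonglongrightarrow> 0"
      by (rule tendsto_mult_right_zero)
    then have "eventually (\<lambda>k. 2 * H * u k powr (\<tau> - 1) < \<delta>) sequentially"
      using \<open>\<delta> > 0\<close> by (rule order_tendstoD)
    \<comment> \<open>The distance bound is available only for positive indices, so
      \<open>k \<ge> 1\<close> is demanded together with smallness.\<close>
    from eventually_conj[OF eventually_ge_at_top[of 1] this]
    obtain k where k: "k \<ge> 1" "2 * H * u k powr (\<tau> - 1) < \<delta>"
      by (auto dest: eventually_happens)
    have "\<delta> \<le> dist_int (of_int (q k) * \<beta>)"
      unfolding \<delta>_def using fin k(1) by (intro Min_le) auto
    then show False
      using \<beta>_bound[OF k(1)] k(2) by linarith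
  qed
  moreover have "dist_int (of_int (q k) * \<alpha>)
      \<le> (2 * H) powr (2 / (1 + \<tau>)) * (of_int (d (h k + 1)) + 1)
          / of_int (q k) powr ((1 - \<tau>) / (1 + \<tau>))" if "k \<ge> 1" for k
  proof -
    \<comment> \<open>This makes the factor \<open>d (h k + 1) + 1\<close> nonnegative, so
      \<open>elim\<close> can be multiplied by it and chained with
      \<open>\<alpha>_bound\<close>.\<close>
    have "d (h k + 1) \<ge> 1"
      using d by simp
    then show ?thesis
      using order_trans[OF \<alpha>_bound[OF that] mult_right_mono[OF elim[OF that]]] by simp
  qed
  moreover have "dist_int (of_int (q k) * \<beta>)
      \<le> (2 * H) powr (2 / (1 + \<tau>)) / of_int (q k) powr ((1 - \<tau>) / (1 + \<tau>))" if "k \<ge> 1" for k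
    using \<beta>_bound[OF that] elim[OF that] by linarith
  ultimately show ?thesis
    by blast
qed

end
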